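(* Let $k\geq 4$ be an integer. Then $\mathrm{URT}(k)\geq \tfrac{k-1}{k-2}$. Moreover, the longest word over a $k$-letter alphabet that is undirected $\tfrac{k-1}{k-2}$-free has length $k+3$ (i.e., such a word of length $k+3$ exists and none of length $k+4$ exists).
   Context: For a word $x=x_1\cdots x_n$ (letters $x_i$), its reversal is $x^R=x_n\cdots x_1$. For rational $1<r\leq 2$, an undirected $r$-power is a word $xyx'$ with $x$ nonempty, $x'\in\{x,x^R\}$, and $|xyx'|/|xy|=r$. For real $1<\alpha\leq 2$, a word is undirected $\alpha$-free if none of its factors is an undirected $r$-power for any rational $r\geq\alpha$. Undirected $r$-powers are $k$-avoidable if there is an infinite word over a $k$-letter alphabet that is undirected $r$-free, and $\mathrm{URT}(k)=\inf\{r : \text{undirected } r\text{-powers are } k\text{-avoidable}\}$. *)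

theory Defs
  imports Complex_Main "HOL-Library.Sublist" "HOL-Library.Extended_Real"
begin

text \<open>
  Finite words are lists and infinite words are functions on \<open>nat\<close>; the \<open>k\<close>-letter alphabet is
  \<open>{..<k}\<close>. The range \<open>1 < r \<le> 2\<close> of the exponent is forced by
  \<open>x \<noteq> []\<close> and \<open>length x' = length x\<close>, so it is not repeated in the definition of
  undirected powers.
\<close>

definition undirected_power :: "rat \<Rightarrow> 'a list \<Rightarrow> bool" where
  "undirected_power r w \<longleftrightarrow>
     (\<exists>x y x'. w = x @ y @ x' \<and> x \<noteq> [] \<and> x' \<in> {x, rev x} \<and>
        of_nat (length (x @ y @ x')) / of_nat (length (x @ y)) = r)"

definition undirected_free :: "real \<Rightarrow> 'a list \<Rightarrow> bool" where
  "undirected_free \<alpha> w \<longleftrightarrow>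
     \<not> (\<exists>u r. sublist u w \<and> of_rat r \<ge> \<alpha> \<and> undirected_power r u)"

definition undirected_free_inf :: "real \<Rightarrow> (nat \<Rightarrow> 'a) \<Rightarrow> bool" where
  "undirected_free_inf \<alpha> w \<longleftrightarrow>
     \<not> (\<exists>i n r. of_rat r \<ge> \<alpha> \<and> undirected_power r (map w [i..<i + n]))"

definition undirected_avoidable :: "nat \<Rightarrow> rat \<Rightarrow> bool" where
  "undirected_avoidable k r \<longleftrightarrow>
     (\<exists>w :: nat \<Rightarrow> nat. range w \<subseteq> {..<k} \<and> undirected_free_inf (of_rat r) w)"

text \<open>
  The infimum is taken in the extended reals, so that the infimum of the empty set is \<open>\<infinity>\<close>.
\<close>

definition URT :: "nat \<Rightarrow> ereal" where
  "URT k = Inf {ereal (of_rat r) | r. 1 < r \<and> r \<le> 2 \<and> undirected_avoidable k r}"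

end

theory Submission
  imports Defs
begin

text \<open>
  Put \<open>\<alpha> = (k - 1)/(k - 2)\<close>. A word is undirected \<open>\<alpha>\<close>-free iff it has no factor \<open>x y x'\<close> with
  \<open>|x y| \<le> (k - 2)|x|\<close>. For \<open>|x| = 1\<close> this says that any \<open>k - 1\<close> consecutive letters are
  distinct, so each further letter either repeats the letter \<open>k - 1\<close> positions earlier (code 0) or
  is the unique letter missing from the preceding \<open>k - 1\<close> ones (code 1). Each of the codes 00, 111
  and 101 forces some pair of adjacent letters to recur, directly or reversed, at
  distance \<open>k - 1\<close> or \<open>k\<close>, which is at most \<open>2(k - 2)\<close>. Every code of length 5 contains one of
  these, while the code 0110 yields the extremal word \<open>0 1 \<dots> (k-2) 0 (k-1) 1 3\<close> of
  length \<open>k + 3\<close> (for \<open>k = 4\<close> the last letter is 0).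
\<close>

section \<open>Freeness as an inequality between lengths\<close>

lemma undirected_exponent_ge_iff:
  fixes k p q :: nat
  assumes "k \<ge> 3" and "q > 0"
  shows "(real k - 1) / (real k - 2) \<le> of_rat (of_nat (q + p) / of_nat q) \<longleftrightarrow> q \<le> p * (k - 2)"
proof -
  have "(of_rat (of_nat (q + p) / of_nat q) :: real) = 1 + real p / real q"
    using assms by (simp add: of_rat_divide of_rat_add add_divide_distrib)
  moreover have "(real k - 1) / (real k - 2) = 1 + 1 / (real k - 2)"
    using assms by (simp add: field_simps)
  moreover have "1 / (real k - 2) \<le> real p / real q \<longleftrightarrow> real q \<le> real (p * (k - 2))"
    using assms by (simp add: field_simps of_nat_diff)
  ultimately show ?thesis
    by (simp only: of_nat_le_iff add_le_cancel_left)
qed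

text \<open>Here \<open>p\<close> is |x|, \<open>q\<close> is |x y| and \<open>i\<close> is the
  start of the factor; \<open>p \<le> q\<close> leaves room for an empty y. The exponent is 1 + p/q
  and the threshold is 1 + 1/(k - 2), so freeness becomes a condition on natural numbers
  only.\<close>

lemma undirected_free_iff:
  fixes k :: nat and w :: "'a list"
  assumes k: "k \<ge> 3"
  shows "undirected_free ((real k - 1) / (real k - 2)) w \<longleftrightarrow>
    (\<forall>i p q. 0 < p \<and> p \<le> q \<and> q \<le> p * (k - 2) \<and> i + q + p \<le> length w \<longrightarrow>
       take p (drop (i + q) w) \<notin> {take p (drop i w), rev (take p (drop i w))})"
    (is "?L \<longleftrightarrow> ?R")
proof
  assume L: ?L
  show ?R
  proof (intro allI impI notI)
    fix i p q
    assume h: "0 < p \<and> p \<le> q \<and> q \<le> p * (k - 2) \<and> i + q + p \<le> length w"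
    define x where "x = take p (drop i w)"
    define y where "y = take (q - p) (drop (i + p) w)"
    define x' where "x' = take p (drop (i + q) w)"
    assume "take p (drop (i + q) w) \<in> {take p (drop i w), rev (take p (drop i w))}"
    then have x': "x' \<in> {x, rev x}"
      by (simp add: x_def x'_def)
    have len: "length x = p" "length y = q - p" "length x' = p"
      using h by (auto simp: x_def y_def x'_def)
    have "take (p + ((q - p) + p)) (drop i w) = x @ y @ x'"
      using h unfolding x_def y_def x'_def take_add by (simp add: add.commute)
    then have "w = take i w @ (x @ y @ x') @ drop (p + ((q - p) + p)) (drop i w)"
      by (metis append_take_drop_id)
    then have "sublist (x @ y @ x') w"
      unfolding sublist_def by blast
    moreover have "undirected_power (of_nat (q + p) / of_nat q) (x @ y @ x')"
      unfolding undirected_power_def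
      by (rule exI[of _ x], rule exI[of _ y], rule exI[of _ x']) (use h x' len in auto)
    moreover have "(real k - 1) / (real k - 2) \<le> of_rat (of_nat (q + p) / of_nat q)"
      using h by (subst undirected_exponent_ge_iff[OF k]) auto
    ultimately show False
      using L unfolding undirected_free_def by blast
  qed
next
  assume R: ?R
  show ?L
    unfolding undirected_free_def
  proof
    assume "\<exists>u r. sublist u w \<and> of_rat r \<ge> (real k - 1) / (real k - 2) \<and> undirected_power r u"
    then obtain x y x' r where
      s: "sublist (x @ y @ x') w" and r: "of_rat r \<ge> (real k - 1) / (real k - 2)" and
      x: "x \<noteq> []" and x': "x' \<in> {x, rev x}" and
      e: "of_nat (length (x @ y @ x')) / of_nat (length (x @ y)) = r"
      unfolding undirected_power_def by blast
    obtain a b where w: "w = a @ (x @ y @ x') @ b"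
      using s unfolding sublist_def by blast
    define p q where "p = length x" and "q = length (x @ y)"
    have len: "length x' = p"
      using x' by (auto simp: p_def)
    have pq: "0 < p" "p \<le> q"
      using x by (auto simp: p_def q_def)
    have "r = of_nat (q + p) / of_nat q"
      using e len by (simp add: p_def q_def add_ac)
    then have "q \<le> p * (k - 2)"
      using r undirected_exponent_ge_iff[OF k, of q p] pq by simp
    moreover have "length a + q + p \<le> length w"
      using w len by (simp add: p_def q_def)
    moreover have "take p (drop (length a) w) = x" "take p (drop (length a + q) w) = x'"
      using w len by (simp_all add: p_def q_def)
    ultimately show False
      using R pq x' by metis
  qed
qed

lemma undirected_free_antimono:
  "undirected_free \<alpha> w \<Longrightarrow> \<alpha> \<le> \<beta> \<Longrightarrow> undirected_free \<beta> w"
  unfolding undirected_free_def by (meson order_trans)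

lemma undirected_free_prefix_of_inf:
  assumes "undirected_free_inf \<alpha> w"
  shows "undirected_free \<alpha> (map w [0..<n])"
  unfolding undirected_free_def
proof
  assume "\<exists>u r. sublist u (map w [0..<n]) \<and> of_rat r \<ge> \<alpha> \<and> undirected_power r u"
  then obtain u r a b where h: "of_rat r \<ge> \<alpha>" "undirected_power r u"
    and e: "map w [0..<n] = a @ u @ b"
    unfolding sublist_def by blast
  have n: "n = length a + length u + length b"
    using arg_cong[OF e, of length] by simp
  have "u = take (length u) (drop (length a) (map w [0..<n]))"
    by (simp add: e)
  also have "\<dots> = map w [length a..<length a + length u]"
    by (simp add: n drop_map take_map)
  finally show False
    using assms h unfolding undirected_free_inf_def by metis
qed

section \<open>Upper bound on the length\<close>

lemma take_Suc_0_drop: "i < length w \<Longrightarrow> take (Suc 0) (drop i w) = [w ! i]"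
  by (simp add: take_Suc_conv_app_nth)

lemma take_2_drop: "Suc i < length w \<Longrightarrow> take 2 (drop i w) = [w ! i, w ! Suc i]"
  by (simp add: numeral_2_eq_2 take_Suc_conv_app_nth)

lemma free_word_length_le:
  fixes k :: nat and w :: "nat list"
  assumes k: "k \<ge> 4" and set: "set w \<subseteq> {..<k}"
    and free: "undirected_free ((real k - 1) / (real k - 2)) w"
  shows "length w \<le> k + 3"
proof (rule ccontr)
  assume "\<not> length w \<le> k + 3"
  then have len: "k + 4 \<le> length w"
    by simp
  define f where "f i = w ! i" for i
  have R: "take p (drop (i + q) w) \<notin> {take p (drop i w), rev (take p (drop i w))}"
    if "0 < p" "p \<le> q" "q \<le> p * (k - 2)" "i + q + p \<le> length w" for i p q
    using free that k by (subst (asm) undirected_free_iff) auto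
  \<comment> \<open>The case |x| = 1 forbids equal letters at distances 1 to k - 2.\<close>
  have D: "f i \<noteq> f j" if "i < j" "j + 2 \<le> i + k" "j < k + 4" for i j
  proof -
    define q where "q = j - i"
    have "j = i + q" "1 \<le> q" "q \<le> k - 2"
      using that unfolding q_def by linarith+
    then show ?thesis
      using R[of 1 q i] that len by (auto simp: f_def take_Suc_0_drop)
  qed
  \<comment> \<open>The case |x| = 2 allows distances up to 2(k - 2), and k \<le> 2(k - 2) because k
    \<ge> 4.\<close>
  have P: "\<not> (f (i + q) = f i \<and> f (Suc (i + q)) = f (Suc i))"
          "\<not> (f (i + q) = f (Suc i) \<and> f (Suc (i + q)) = f i)"
    if "2 \<le> q" "q \<le> k" "i + q + 1 < k + 4" for i q
    using R[of 2 q i] that len k by (auto simp: f_def take_2_drop)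
  \<comment> \<open>\<open>c i\<close> says that the letter at position i + k - 1 has code 0; the
    first k + 4 letters give the five codes i = 0, ..., 4.\<close>
  define c where "c i \<longleftrightarrow> f (i + (k - 1)) = f i" for i
  \<comment> \<open>By \<open>D\<close> and code 1, the k letters from position i on are pairwise
    distinct, so they exhaust the alphabet and every letter of the word is among them.\<close>
  have onto: "\<exists>t<k. f m = f (i + t)" if "\<not> c i" "i < 5" "m < k + 4" for i m
  proof -
    have neq: "f a \<noteq> f b" if "i \<le> a" "a < b" "b < i + k" for a b
    proof (cases "b + 2 \<le> a + k")
      case True
      then show ?thesis
        using D[of a b] that \<open>i < 5\<close> by auto
    next
      case False
      then have "a = i" "b = i + (k - 1)"
        using that by auto
      then show ?thesis
        using \<open>\<not> c i\<close> by (auto simp: c_def)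
    qed
    have "inj_on f {i..<i + k}"
      by (rule linorder_inj_onI) (use neq in auto)
    then have "card (f ` {i..<i + k}) = card {..<k}"
      by (simp add: card_image)
    moreover have sub: "f j < k" if "j < k + 4" for j
      using subsetD[OF set nth_mem[of j w]] len that by (simp add: f_def)
    moreover have "f ` {i..<i + k} \<subseteq> {..<k}"
      using sub \<open>i < 5\<close> by auto
    ultimately have "f ` {i..<i + k} = {..<k}"
      by (metis card_subset_eq finite_lessThan)
    then have "f m \<in> f ` {i..<i + k}"
      using sub \<open>m < k + 4\<close> by auto
    then obtain j where "i \<le> j" "j < i + k" "f m = f j"
      by auto
    then show ?thesis
      by (intro exI[of _ "j - i"]) auto
  qed
  \<comment> \<open>Of the k possible offsets t, the second code 1 excludes t = 1 and
    \<open>D\<close> excludes t \<ge> 2.\<close>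
  have code_11: "f (i + k) = f i" if "\<not> c i" "\<not> c (Suc i)" "i < 4" for i
  proof -
    obtain t where t: "t < k" "f (i + k) = f (i + t)"
      using onto[of i "i + k"] \<open>\<not> c i\<close> \<open>i < 4\<close> by auto
    have "t \<noteq> 1"
      using t \<open>\<not> c (Suc i)\<close> k by (auto simp: c_def)
    moreover have "\<not> 2 \<le> t"
      using D[of "i + t" "i + k"] t \<open>i < 4\<close> by auto
    ultimately have "t = 0"
      by linarith
    then show ?thesis
      using t by simp
  qed
  \<comment> \<open>The code 0 in the middle puts the letter of position i + 1 right before the new
    one, which excludes t = 1; the last code 1 excludes t = 2, and \<open>D\<close> excludes the
    rest.\<close>
  have code_101: "f (Suc (i + k)) = f i" if "\<not> c i" "c (Suc i)" "\<not> c (Suc (Suc i))" "i < 3" for i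
  proof -
    obtain t where t: "t < k" "f (Suc (i + k)) = f (i + t)"
      using onto[of i "Suc (i + k)"] \<open>\<not> c i\<close> \<open>i < 3\<close> by auto
    have "t \<noteq> 1"
      using t \<open>c (Suc i)\<close> D[of "i + k" "Suc (i + k)"] k \<open>i < 3\<close> by (auto simp: c_def)
    moreover have "t \<noteq> 2"
      using t \<open>\<not> c (Suc (Suc i))\<close> k by (auto simp: c_def)
    moreover have "\<not> 3 \<le> t"
      using D[of "i + t" "Suc (i + k)"] t \<open>i < 3\<close> by auto
    ultimately have "t = 0"
      by linarith
    then show ?thesis
      using t by simp
  qed
  have no_00: "\<not> (c i \<and> c (Suc i))" if "i < 4" for i
    using P(1)[of "k - 1" i] that k by (auto simp: c_def)
  \<comment> \<open>Two overlapping uses of \<open>code_11\<close> repeat an adjacent pair at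
    distance k.\<close>
  have no_111: "c i \<or> c (Suc i) \<or> c (Suc (Suc i))" if "i < 3" for i
    using P(1)[of k i] code_11[of i] code_11[of "Suc i"] that k by auto
  \<comment> \<open>Here f(i + k) = f(i + 1) and f(i + k + 1) = f(i): the pair returns reversed at
    distance k.\<close>
  have no_101: "\<not> (\<not> c i \<and> c (Suc i) \<and> \<not> c (Suc (Suc i)))" if "i < 3" for i
    using P(2)[of k i] code_101[of i] that k by (auto simp: c_def)
  show False
    using no_00[of 0] no_00[of 1] no_00[of 2] no_00[of 3]
      no_111[of 0] no_111[of 1] no_111[of 2]
      no_101[of 0] no_101[of 1] no_101[of 2]
    by (auto simp: eval_nat_numeral)
qed

section \<open>The extremal word\<close>

definition extremal_word :: "nat \<Rightarrow> nat list" where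
  "extremal_word k = [0..<k - 1] @ [0, k - 1, 1, if k = 4 then 0 else 3]"

lemma nth_extremal_word:
  assumes "k \<ge> 4" and "i < k + 3"
  shows "extremal_word k ! i =
    (if i < k - 1 then i else if i = k - 1 then 0 else if i = k then k - 1
     else if i = k + 1 then 1 else if k = 4 then 0 else 3)"
proof -
  consider "i < k - 1" | "i = k - 1" | "i = k" | "i = k + 1" | "i = k + 2"
    using assms by linarith
  then show ?thesis
    by cases (use assms in \<open>auto simp: extremal_word_def nth_append nth_Cons'\<close>)
qed

lemma extremal_word_distance:
  assumes "k \<ge> 4" and "i < j" and "j < k + 3" and "extremal_word k ! i = extremal_word k ! j"
  shows "j - i \<ge> k - 1"
  using assms by (auto simp: nth_extremal_word split: if_splits)

text \<open>The exception is real: for k = 4 the word is 0120310, where 01 returns as 10. Its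
  distance 5 exceeds 2(k - 2) = 4, so it is harmless.\<close>

lemma extremal_word_adjacent_pairs:
  assumes "k \<ge> 4" and "i < j" and "Suc j < k + 3"
    and "extremal_word k ! i = extremal_word k ! j \<and>
           extremal_word k ! Suc i = extremal_word k ! Suc j \<or>
         extremal_word k ! i = extremal_word k ! Suc j \<and>
           extremal_word k ! Suc i = extremal_word k ! j"
  shows "k = 4 \<and> i = 0 \<and> j = 5"
  using assms by (auto simp: nth_extremal_word split: if_splits)

lemma extremal_word_free:
  assumes k: "k \<ge> 4"
  shows "undirected_free ((real k - 1) / (real k - 2)) (extremal_word k)"
proof -
  have "take p (drop (i + q) (extremal_word k)) \<notin>
          {take p (drop i (extremal_word k)), rev (take p (drop i (extremal_word k)))}"
    if h: "0 < p" "p \<le> q" "q \<le> p * (k - 2)" "i + q + p \<le> length (extremal_word k)" for i p q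
  proof
    define f where "f i = extremal_word k ! i" for i
    have len: "length (extremal_word k) = k + 3"
      using k by (simp add: extremal_word_def)
    assume "take p (drop (i + q) (extremal_word k)) \<in>
        {take p (drop i (extremal_word k)), rev (take p (drop i (extremal_word k)))}"
    then consider "\<And>t. t < p \<Longrightarrow> f (i + q + t) = f (i + t)"
      | "\<And>t. t < p \<Longrightarrow> f (i + q + t) = f (i + (p - 1 - t))"
    proof (elim insertE emptyE)
      assume e: "take p (drop (i + q) (extremal_word k)) = take p (drop i (extremal_word k))"
      have "f (i + q + t) = f (i + t)" if "t < p" for t
        using arg_cong[OF e, of "\<lambda>u. u ! t"] that h by (simp add: f_def)
      then show ?thesis
        using that(1) by blast
    next
      assume e: "take p (drop (i + q) (extremal_word k)) = rev (take p (drop i (extremal_word k)))"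
      have "f (i + q + t) = f (i + (p - 1 - t))" if "t < p" for t
        using arg_cong[OF e, of "\<lambda>u. u ! t"] that h by (simp add: f_def rev_nth)
      then show ?thesis
        using that(2) by blast
    qed
    note eq = this
    show False
    proof (cases "p = 1")
      case True
      have "f i = f (i + q)"
        using eq by cases (use True in force)+
      then show False
        using extremal_word_distance[OF k, of i "i + q"] h True len k by (auto simp: f_def)
    next
      case False
      \<comment> \<open>Each adjacent pair of x, at offset \<open>s\<close>, recurs in x' at some
        position \<open>j\<close>, so it must be the exceptional pair. For p = 2 the only choice is
        j = i + q, which pins down q.\<close>
      have pair: "\<exists>j \<ge> i + q. (p = 2 \<longrightarrow> j = i + q) \<and> k = 4 \<and> i + s = 0 \<and> j = 5"
        if s: "s + 1 < p" for s
        using eq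
      proof cases
        case 1
        have "f (i + q + s) = f (i + s)" "f (i + q + Suc s) = f (i + Suc s)"
          using 1[of s] 1[of "Suc s"] s by auto
        then show ?thesis
          using extremal_word_adjacent_pairs[OF k, of "i + s" "i + q + s"] h s len
          by (intro exI[of _ "i + q + s"]) (auto simp: f_def)
      next
        case 2
        \<comment> \<open>Reversal sends offsets s and s + 1 of x to p - 1 - s and p - 2 - s of x',
          so the mirrored pair starts at the latter.\<close>
        define j where "j = i + q + (p - 2 - s)"
        have "f j = f (i + Suc s)" "f (Suc j) = f (i + s)"
          using 2[of "p - 2 - s"] 2[of "Suc (p - 2 - s)"] s by (auto simp: j_def Suc_diff_Suc)
        moreover have "i + s < j" "Suc j < k + 3"
          using h s len by (auto simp: j_def)
        ultimately show ?thesis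
          using extremal_word_adjacent_pairs[OF k, of "i + s" j] s
          by (intro exI[of _ j]) (auto simp: f_def j_def)
      qed
      \<comment> \<open>For p = 2 the exception gives q = 5 > 4. For p \<ge> 3 the pair at offset 1
        would have to start at position 0.\<close>
      show False
      proof (cases "p = 2")
        case True
        then show False
          using pair[of 0] h by auto
      next
        case False
        then show False
          using pair[of 1] h \<open>p \<noteq> 1\<close> by auto
      qed
    qed
  qed
  then show ?thesis
    using k by (subst undirected_free_iff) auto
qed

theorem theorem5:
  fixes k :: nat
  assumes "k \<ge> 4"
  shows "URT k \<ge> ereal ((real k - 1) / (real k - 2)) \<and>
    (\<exists>w :: nat list. set w \<subseteq> {..<k} \<and>
       undirected_free ((real k - 1) / (real k - 2)) w \<and> length w = k + 3) \<and>
    (\<forall>w :: nat list. set w \<subseteq> {..<k} \<and>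
       undirected_free ((real k - 1) / (real k - 2)) w \<longrightarrow> length w \<le> k + 3)"
proof (intro conjI)
  have "(real k - 1) / (real k - 2) \<le> of_rat r" if av: "undirected_avoidable k r" for r
  proof (rule ccontr)
    assume "\<not> ?thesis"
    moreover obtain w :: "nat \<Rightarrow> nat" where
      w: "range w \<subseteq> {..<k}" "undirected_free_inf (of_rat r) w"
      using av unfolding undirected_avoidable_def by blast
    \<comment> \<open>An exponent below the threshold makes freeness stronger, so a prefix of length
      k + 4 would contradict the length bound.\<close>
    ultimately have "undirected_free ((real k - 1) / (real k - 2)) (map w [0..<k + 4])"
      using undirected_free_antimono undirected_free_prefix_of_inf by fastforce
    moreover have "set (map w [0..<k + 4]) \<subseteq> {..<k}"
      using w by auto
    ultimately have "length (map w [0..<k + 4]) \<le> k + 3"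
      using free_word_length_le[OF assms] by blast
    then show False
      by simp
  qed
  then show "URT k \<ge> ereal ((real k - 1) / (real k - 2))"
    unfolding URT_def by (auto intro!: Inf_greatest)
  have "set (extremal_word k) \<subseteq> {..<k}" "length (extremal_word k) = k + 3"
    using assms by (auto simp: extremal_word_def)
  then show "\<exists>w :: nat list. set w \<subseteq> {..<k} \<and>
      undirected_free ((real k - 1) / (real k - 2)) w \<and> length w = k + 3"
    using extremal_word_free[OF assms] by blast
  show "\<forall>w :: nat list. set w \<subseteq> {..<k} \<and>
      undirected_free ((real k - 1) / (real k - 2)) w \<longrightarrow> length w \<le> k + 3"
    using free_word_length_le[OF assms] by blast
qed

end
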